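(* Let $k$ be a positive even integer. Assume that there exists a prime $p\ge 13$ such that $p\equiv 1\pmod 4$ and $k$ is a positive odd multiple of $(p-1)/2$. Then there exists an even integer $l$ with $2\le l\le p-3$ such that for every positive integer $l'$ with $l'\equiv l\pmod p$ we have $g_{k,l'}(p)\notin\mathbb{Z}_{(p)}$, and hence $N_{k,l'}\le p$.
   Context: For integers $k\ge 2$ and $l\ge 0$, the $(k,l)$-Göbel sequence $(g_{k,l}(n))_{n\ge 1}$ is the sequence of rational numbers defined by $$g_{k,l}(n)=\frac1n\Bigl(l+\sum_{i=1}^{n-1}g_{k,l}(i)^k\Bigr)\qquad(n\ge 1),$$ so that $g_{k,l}(1)=l$; equivalently $(n+1)g_{k,l}(n+1)=g_{k,l}(n)\bigl(n+g_{k,l}(n)^{k-1}\bigr)$. Put $N_{k,l}=\inf\{n\in\mathbb{Z}_{\ge 1}\mid g_{k,l}(n)\notin\mathbb{Z}\}$, with $N_{k,l}=\infty$ if all terms are integers. For a prime $p$, $\mathbb{Z}_{(p)}\subset\mathbb{Q}$ denotes the localization of $\mathbb{Z}$ at the prime ideal $(p)$. *)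

theory Defs
  imports Complex_Main "HOL-Library.Extended_Nat" "HOL-Number_Theory.Number_Theory"
begin

text \<open>
  The Goebel sequence is indexed by \<open>n \<ge> 1\<close>; the value at \<open>n = 0\<close> is the irrelevant \<open>l / 0 = 0\<close>.
\<close>

function goebel :: "nat \<Rightarrow> nat \<Rightarrow> nat \<Rightarrow> rat" where
  "goebel k l n = (of_nat l + (\<Sum>i\<in>{1..<n}. goebel k l i ^ k)) / of_nat n"
  by auto
termination by (relation "measure (\<lambda>(k, l, n). n)") auto

text \<open>The defining equation loops as a rewrite rule.\<close>

declare goebel.simps [simp del]

lemma goebel_1: "goebel k l 1 = of_nat l"
  by (subst goebel.simps) simp

lemma goebel_Suc:
  assumes "k \<ge> 1" "n \<ge> 1"
  shows "of_nat (n + 1) * goebel k l (n + 1) = goebel k l n * (of_nat n + goebel k l n ^ (k - 1))"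
proof -
  have n: "of_nat n * goebel k l n = of_nat l + (\<Sum>i\<in>{1..<n}. goebel k l i ^ k)"
    using assms by (subst goebel.simps) simp
  have "of_nat (n + 1) * goebel k l (n + 1) = of_nat l + (\<Sum>i\<in>{1..<n + 1}. goebel k l i ^ k)"
    by (subst goebel.simps) (simp del: of_nat_add of_nat_Suc)
  also have "\<dots> = of_nat n * goebel k l n + goebel k l n ^ k"
    using assms n by simp
  also have "goebel k l n ^ k = goebel k l n * goebel k l n ^ (k - 1)"
    using assms by (cases k) simp_all
  finally show ?thesis
    by (simp add: algebra_simps)
qed

text \<open>In \<^typ>\<open>enat\<close> the infimum of the empty set is \<open>\<infinity>\<close>.\<close>

definition goebel_N :: "nat \<Rightarrow> nat \<Rightarrow> enat" where
  "goebel_N k l = Inf {enat n | n. n \<ge> 1 \<and> goebel k l n \<notin> \<int>}"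

definition int_localization :: "nat \<Rightarrow> rat set" where
  "int_localization p = {of_int a / of_int b | a b. \<not> int p dvd b}"

end

theory Submission
  imports Defs
begin

text \<open>
  Modulo \<open>p\<close> the power \<open>x ^ k\<close> is the quadratic character \<open>chi x\<close>, so \<open>w n = n * g n\<close> satisfies
  \<open>w (n + 1) = w n + chi n * chi (w n)\<close>: a walk with steps \<open>1\<close> or \<open>-1\<close> on \<open>{0..p}\<close> that is absorbed
  at both ends, and \<open>g p\<close> is \<open>p\<close>-integral iff the walk is absorbed by time \<open>p\<close>.
  If all even starting points are absorbed, two neighbours \<open>l\<close> and \<open>l + 2\<close> are absorbed at 0 and at
  \<open>p\<close>, respectively. As \<open>chi (-1) = 1\<close>, the reversed and reflected walk from \<open>l + 2\<close> obeys the same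
  rule and cannot cross the walk from \<open>l\<close>. This leaves them together only \<open>p - 2\<close> steps, so both
  move in straight lines. With \<open>a = l + 1\<close> this means \<open>chi (a - n) = - chi n\<close> for \<open>0 < n < a\<close> and
  \<open>chi (a + n) = chi n\<close> for \<open>0 < n < p - a\<close>, which contradicts
  \<open>(\<Sum>n. chi n * chi (n + a)) = -1\<close> together with the values of \<open>chi\<close> at \<open>n \<le> 10\<close>.
\<close>

section \<open>The quadratic character modulo p\<close>

locale prime_1_mod_4 =
  fixes p :: nat
  assumes prime_p: "prime p" and p_mod_4: "[p = 1] (mod 4)"
begin

definition chi :: "int \<Rightarrow> int" where
  "chi x = Legendre x (int p)"

lemma p_ge_5: "p \<ge> 5"
proof -
  have "p mod 4 = 1" using p_mod_4 by (simp add: cong_def)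
  moreover have "p > 1" using prime_p prime_gt_1_nat by blast
  ultimately show ?thesis by presburger
qed

lemma prime_int_p: "prime (int p)"
  using prime_p by simp

lemma chi_cases: "chi x = 0 \<or> chi x = 1 \<or> chi x = -1"
  by (auto simp: chi_def Legendre_def)

lemma chi_eq_0_iff: "chi x = 0 \<longleftrightarrow> int p dvd x"
  by (auto simp: chi_def Legendre_def cong_0_iff)

lemma chi_power: "[chi x = x ^ ((p - 1) div 2)] (mod int p)"
  unfolding chi_def using euler_criterion[OF prime_p] p_ge_5 by simp

text \<open>Two such values differ by at most 2, which is less than p. This turns congruences from
  Euler's criterion into equalities.\<close>

lemma sign_eq_if_cong:
  assumes "[u = v] (mod int p)" "u = 0 \<or> u = 1 \<or> u = -1" "v = 0 \<or> v = 1 \<or> v = -1"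
  shows "u = v"
proof (rule ccontr)
  assume "u \<noteq> v"
  moreover have "int p dvd u - v" using assms(1) by (simp add: cong_iff_dvd_diff)
  ultimately have "int p \<le> \<bar>u - v\<bar>"
    using dvd_imp_le_int[of "u - v" "int p"] by simp
  then show False using assms(2,3) p_ge_5 by auto
qed

lemma chi_cong: "[x = y] (mod int p) \<Longrightarrow> chi x = chi y"
  by (rule sign_eq_if_cong[OF _ chi_cases chi_cases])
    (metis chi_power cong_pow cong_sym cong_trans)

lemma chi_mult: "chi (x * y) = chi x * chi y"
proof (rule sign_eq_if_cong)
  have "[chi x * chi y = (x * y) ^ ((p - 1) div 2)] (mod int p)"
    using cong_mult[OF chi_power chi_power] by (simp add: power_mult_distrib)
  then show "[chi (x * y) = chi x * chi y] (mod int p)"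
    by (metis chi_power cong_sym cong_trans)
qed (use chi_cases[of x] chi_cases[of y] chi_cases[of "x * y"] in auto)

lemma chi_0 [simp]: "chi 0 = 0"
  by (simp add: chi_eq_0_iff)

lemma chi_p [simp]: "chi (int p) = 0"
  by (simp add: chi_eq_0_iff)

lemma chi_1 [simp]: "chi 1 = 1"
  by (rule sign_eq_if_cong[OF _ chi_cases]) (use chi_power[of 1] in auto)

lemma chi_square: "\<not> int p dvd x \<Longrightarrow> chi x * chi x = 1"
  using chi_cases[of x] chi_eq_0_iff[of x] by auto

text \<open>Since p is 1 modulo 4, the exponent (p - 1) / 2 is even, so -1 is a residue. The
  reflection of walks rests on this.\<close>

lemma chi_uminus [simp]: "chi (- x) = chi x"
proof -
  have "even ((p - 1) div 2)"
    using p_mod_4 by (simp add: cong_def) presburger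
  then have "chi (-1) = 1"
    using chi_power[of "-1"] by (intro sign_eq_if_cong[OF _ chi_cases]) auto
  then show ?thesis using chi_mult[of "-1" x] by simp
qed

lemma chi_diff_p: "chi (int p - x) = chi x"
  using chi_cong[of "int p - x" "- x"] by (simp add: cong_iff_dvd_diff)

lemma nonresidue_exists: "\<exists>u. chi u = -1"
proof -
  obtain g where g: "residue_primroot p g"
    using prime_primitive_root_exists[of p] prime_p prime_gt_1_nat by blast
  have "chi (int g) \<noteq> 1"
  proof
    assume "chi (int g) = 1"
    then have "[int (g ^ ((p - 1) div 2)) = int 1] (mod int p)"
      using chi_power[of "int g"] by (simp add: cong_sym)
    then have "[g ^ ((p - 1) div 2) = 1] (mod p)" by (simp only: cong_int_iff)
    then have "ord p g dvd (p - 1) div 2" using ord_divides by blast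
    moreover have "ord p g = p - 1"
      using g prime_p by (simp add: residue_primroot_def totient_prime)
    moreover have "0 < (p - 1) div 2" "(p - 1) div 2 < p - 1" using p_ge_5 by auto
    ultimately show False by (metis nat_dvd_not_less)
  qed
  moreover have "chi (int g) \<noteq> 0"
  proof
    assume "chi (int g) = 0"
    then have "p dvd g" by (simp add: chi_eq_0_iff)
    moreover have "coprime p g" using g by (simp add: residue_primroot_def)
    ultimately show False using prime_p by (metis coprime_absorb_left not_prime_unit)
  qed
  ultimately show ?thesis using chi_cases by blast
qed

section \<open>Character sums over a complete residue system\<close>

lemma sum_residues_affine:
  fixes F :: "int \<Rightarrow> int"
  assumes F: "\<And>x y. [x = y] (mod int p) \<Longrightarrow> F x = F y" and c: "\<not> int p dvd c"
  shows "(\<Sum>x\<in>{0..<int p}. F (c * x + d)) = (\<Sum>x\<in>{0..<int p}. F x)"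
proof -
  let ?f = "\<lambda>x. (c * x + d) mod int p"
  have inj: "inj_on ?f {0..<int p}"
  proof (rule inj_onI)
    fix x y assume xy: "x \<in> {0..<int p}" "y \<in> {0..<int p}" "?f x = ?f y"
    then have "[c * x = c * y] (mod int p)"
      using cong_add_rcancel[of "c * x" d "c * y"] by (simp add: cong_def)
    moreover have "coprime c (int p)"
      using c prime_int_p by (metis coprime_commute prime_imp_coprime)
    ultimately have "[x = y] (mod int p)" by (metis cong_mult_lcancel)
    then show "x = y" using xy by (simp add: cong_def)
  qed
  moreover have sub: "?f ` {0..<int p} \<subseteq> {0..<int p}" using p_ge_5 by auto
  ultimately have "bij_betw ?f {0..<int p} {0..<int p}"
    by (metis bij_betw_def endo_inj_surj finite_atLeastLessThan_int)
  then have "(\<Sum>x\<in>{0..<int p}. F x) = (\<Sum>x\<in>{0..<int p}. F (?f x))"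
    by (rule sum.reindex_bij_betw[symmetric])
  also have "\<dots> = (\<Sum>x\<in>{0..<int p}. F (c * x + d))"
    by (intro sum.cong F) (auto simp: cong_def)
  finally show ?thesis by simp
qed

text \<open>Multiplication by a nonresidue permutes the residues and flips the sign of the
  sum.\<close>

lemma sum_chi: "(\<Sum>x\<in>{0..<int p}. chi x) = 0"
proof -
  obtain u where u: "chi u = -1" using nonresidue_exists by blast
  then have "\<not> int p dvd u" using chi_eq_0_iff[of u] by auto
  then have "(\<Sum>x\<in>{0..<int p}. chi x) = (\<Sum>x\<in>{0..<int p}. chi (u * x))"
    using sum_residues_affine[of chi u 0] chi_cong by simp
  also have "\<dots> = - (\<Sum>x\<in>{0..<int p}. chi x)"
    by (simp add: chi_mult u sum_negf)
  finally show ?thesis by simp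
qed

text \<open>Substituting \<open>a * x\<close> for \<open>x\<close> pulls out the factor
  \<open>chi a * chi a = 1\<close>.\<close>

lemma sum_chi_shift_eq:
  assumes "\<not> int p dvd a"
  shows "(\<Sum>x\<in>{0..<int p}. chi x * chi (x + a)) = (\<Sum>x\<in>{0..<int p}. chi x * chi (x + 1))"
proof -
  have "(\<Sum>x\<in>{0..<int p}. chi x * chi (x + a)) = (\<Sum>x\<in>{0..<int p}. chi (a * x) * chi (a * x + a))"
    using sum_residues_affine[of "\<lambda>x. chi x * chi (x + a)" a 0, OF _ assms]
      chi_cong cong_add[OF _ cong_refl] by (metis (no_types, lifting) add_0_right sum.cong)
  also have "\<dots> = (\<Sum>x\<in>{0..<int p}. chi x * chi (x + 1))"
  proof (rule sum.cong)
    fix x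
    have "chi (a * x + a) = chi a * chi (x + 1)"
      by (simp add: distrib_left flip: chi_mult)
    then show "chi (a * x) * chi (a * x + a) = chi x * chi (x + 1)"
      using chi_square[OF assms] by (simp add: chi_mult algebra_simps)
  qed simp
  finally show ?thesis .
qed

text \<open>The correlation at shift \<open>a\<close> does not depend on \<open>a \<noteq> 0\<close>, and all correlations add up to
  \<open>(\<Sum>x. chi x)\<^sup>2 = 0\<close>.\<close>

lemma sum_chi_shift:
  assumes "\<not> int p dvd a"
  shows "(\<Sum>x\<in>{0..<int p}. chi x * chi (x + a)) = -1"
proof -
  let ?I = "{0..<int p}"
  let ?T = "\<lambda>a. \<Sum>x\<in>?I. chi x * chi (x + a)"
  have split: "?I = insert 0 {1..<int p}" using p_ge_5 by auto
  have "?T 0 = (\<Sum>x\<in>{1..<int p}. chi x * chi x)" by (simp add: split)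
  also have "\<dots> = (\<Sum>x\<in>{1..<int p}. 1)"
    by (intro sum.cong chi_square) (auto simp: zdvd_not_zless)
  also have "\<dots> = int p - 1" using p_ge_5 by simp
  finally have T0: "?T 0 = int p - 1" .
  have "(\<Sum>b\<in>?I. ?T b) = (\<Sum>x\<in>?I. chi x * (\<Sum>b\<in>?I. chi (x + b)))"
    by (subst sum.swap) (simp add: sum_distrib_left)
  also have "\<dots> = (\<Sum>x\<in>?I. 0)"
  proof (rule sum.cong)
    fix x
    show "chi x * (\<Sum>b\<in>?I. chi (x + b)) = 0"
      using sum_residues_affine[of chi 1 x] chi_cong sum_chi p_ge_5 by (simp add: add.commute)
  qed simp
  finally have "0 = (\<Sum>b\<in>?I. ?T b)" by simp
  also have "\<dots> = ?T 0 + (\<Sum>b\<in>{1..<int p}. ?T b)"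
    unfolding split[THEN arg_cong, of "\<lambda>I. sum ?T I"] by (subst sum.insert) auto
  also have "(\<Sum>b\<in>{1..<int p}. ?T b) = (\<Sum>b\<in>{1..<int p}. ?T 1)"
    by (intro sum.cong sum_chi_shift_eq) (auto simp: zdvd_not_zless)
  also have "\<dots> = (int p - 1) * ?T 1" using p_ge_5 by simp
  finally have "(int p - 1) * (?T 1 + 1) = 0" using T0 by (simp add: algebra_simps)
  then have "?T 1 = -1" using p_ge_5 by auto
  then show ?thesis using sum_chi_shift_eq[OF assms] by simp
qed

section \<open>Excluding the sign pattern of two straight walks\<close>

lemma chi_prod_sign:
  assumes "\<not> int p dvd x" "\<not> int p dvd y"
  shows "chi x * chi y = 1 \<or> chi x * chi y = -1"
  using assms chi_cases[of x] chi_cases[of y] by (auto simp: chi_eq_0_iff)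

lemma chi_prod_bounds: "\<bar>chi x * chi y\<bar> \<le> 1"
  using chi_cases[of x] chi_cases[of y] by auto

lemma not_dvd_strictly_between: "0 < x \<Longrightarrow> x < int p \<Longrightarrow> \<not> int p dvd x"
  by (simp add: zdvd_not_zless)

text \<open>Summing \<open>chi n * chi (n + a)\<close> over all residues forces \<open>a = (p + 1) / 2\<close>, hence
  \<open>chi (2 * n - 1) = - chi (2 * n)\<close> for small \<open>n\<close>. Then \<open>chi 2 = chi 3 = chi 5 = -1\<close>
  and \<open>chi 9 = - chi 10 = -1\<close>, although 9 is a square.\<close>

lemma no_antisymmetry_symmetry:
  assumes "p \<ge> 13" and a: "1 \<le> a" "a < int p"
    and anti: "\<And>n. 1 \<le> n \<Longrightarrow> n < a \<Longrightarrow> chi n * chi (a - n) = -1"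
    and symm: "\<And>n. 1 \<le> n \<Longrightarrow> n < int p - a \<Longrightarrow> chi n * chi (a + n) = 1"
  shows False
proof -
  let ?f = "\<lambda>x. chi x * chi (x + a)"
  \<comment> \<open>With x = p - a + n, x + a is congruent to n and x to -(a - n), so
    \<open>anti\<close> applies at n.\<close>
  have upper: "?f x = -1" if "x \<in> {int p - a<..<int p}" for x
  proof -
    have "[x + a = x - (int p - a)] (mod int p)" by (simp add: cong_iff_dvd_diff)
    then have "chi (x + a) = chi (x - (int p - a))" by (rule chi_cong)
    moreover have "chi (a - (x - (int p - a))) = chi x" using chi_diff_p[of x] by simp
    ultimately show ?thesis using anti[of "x - (int p - a)"] that by (simp add: mult.commute)
  qed
  have "{0..<int p} = {0, int p - a} \<union> ({1..<int p - a} \<union> {int p - a<..<int p})"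
    using a by auto
  then have "sum ?f {0..<int p}
      = sum ?f {0, int p - a} + (sum ?f {1..<int p - a} + sum ?f {int p - a<..<int p})"
    using a by (simp only:) (subst sum.union_disjoint; auto intro: sum.union_disjoint)
  also have "sum ?f {0, int p - a} = 0" using a by simp
  also have "sum ?f {1..<int p - a} = (\<Sum>x\<in>{1..<int p - a}. 1)"
    by (rule sum.cong) (auto dest: symm simp: add.commute)
  also have "\<dots> = int p - a - 1" using a by simp
  also have "sum ?f {int p - a<..<int p} = (\<Sum>x\<in>{int p - a<..<int p}. -1)"
    by (rule sum.cong) (use upper in auto)
  also have "\<dots> = - (a - 1)" using a by simp
  \<comment> \<open>The terms at 0 and p - a vanish, so the total is p - 2 * a, and it must equal
    -1.\<close>
  finally have pa: "int p = 2 * a - 1"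
    using sum_chi_shift[OF not_dvd_strictly_between, of a] a by simp
  have double: "chi (2 * n - 1) = - chi (2 * n)" if n: "1 \<le> n" "n < a" for n
  proof -
    \<comment> \<open>By \<open>pa\<close>, p - (2 * n - 1) = 2 * (a - n).\<close>
    have "chi (2 * n - 1) = chi (2 * (a - n))"
      using chi_diff_p[of "2 * n - 1"] pa by (simp add: algebra_simps)
    then have *: "chi (2 * n - 1) = chi 2 * chi (a - n)" by (simp only: chi_mult)
    have "\<not> int p dvd n" using n a by (intro not_dvd_strictly_between) auto
    then have "chi n = 1 \<or> chi n = -1" using chi_cases chi_eq_0_iff by blast
    then have "chi (a - n) = - chi n" using anti[OF n] by auto
    then show ?thesis using * by (simp add: chi_mult)
  qed
  have a7: "a \<ge> 7" using pa assms(1) by linarith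
  have "chi 2 = -1" using double[of 1] a7 by simp
  moreover have "chi 3 = - (chi 2 * chi 2)"
    using double[of 2] a7 by (simp flip: chi_mult)
  moreover have "chi 5 = - (chi 2 * chi 3)"
    using double[of 3] a7 by (simp flip: chi_mult)
  moreover have "chi 3 * chi 3 = - (chi 2 * chi 5)"
    using double[of 5] a7 by (simp flip: chi_mult)
  ultimately show False by simp
qed

section \<open>The walk and its absorption\<close>

text \<open>Modulo \<open>p\<close>, \<open>walk l n\<close> is \<open>n\<close> times the \<open>n\<close>-th Goebel number. As \<open>chi 0 = 0\<close>, the start
  value \<open>l\<close> is attained both at time 0 and at time 1.\<close>

primrec walk :: "int \<Rightarrow> nat \<Rightarrow> int" where
  "walk l 0 = l"
| "walk l (Suc n) = walk l n + chi (int n) * chi (walk l n)"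

lemma walk_absorbed:
  assumes "int p dvd walk l m" "m \<le> n"
  shows "walk l n = walk l m"
  using assms(2) by (induction n rule: dec_induct) (use assms(1) chi_eq_0_iff in auto)

lemma walk_diff_le: "m \<le> n \<Longrightarrow> \<bar>walk l n - walk l m\<bar> \<le> int n - int m"
proof (induction n rule: dec_induct)
  case (step n)
  then show ?case using chi_prod_bounds[of "int n" "walk l n"] by simp
qed simp

lemma walk_bounds:
  assumes "0 \<le> l" "l \<le> int p"
  shows "0 \<le> walk l n \<and> walk l n \<le> int p"
proof (induction n)
  case (Suc n)
  then consider "walk l n = 0" | "walk l n = int p" | "0 < walk l n" "walk l n < int p"
    by linarith
  then show ?case
    using chi_prod_bounds[of "int n" "walk l n"] by cases auto
qed (use assms in auto)

text \<open>Before absorption each step at times 1 to p - 1 is 1 or -1. The step at time 0 is 0, so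
  only \<open>n\<close> sign steps precede time \<open>Suc n\<close>.\<close>

lemma walk_parity:
  assumes "n < p" "\<not> int p dvd walk l (Suc n)"
  shows "even (walk l (Suc n) - l - int n)"
  using assms
proof (induction n)
  case (Suc n)
  have "\<not> int p dvd walk l (Suc n)"
  proof
    assume "int p dvd walk l (Suc n)"
    then have "walk l (Suc (Suc n)) = walk l (Suc n)" by (rule walk_absorbed) simp
    then show False using \<open>int p dvd walk l (Suc n)\<close> Suc.prems(2) by metis
  qed
  moreover from this have "even (walk l (Suc n) - l - int n)" using Suc by simp
  moreover have "\<not> int p dvd int (Suc n)"
    using Suc.prems by (intro not_dvd_strictly_between) auto
  ultimately have "walk l (Suc (Suc n)) = walk l (Suc n) + 1 \<or>
      walk l (Suc (Suc n)) = walk l (Suc n) - 1"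
    using chi_prod_sign[of "int (Suc n)" "walk l (Suc n)"] walk.simps(2)[of l "Suc n"] by linarith
  then show ?case using \<open>even (walk l (Suc n) - l - int n)\<close> by (auto simp del: walk.simps)
qed simp

section \<open>Walks absorbed at opposite ends\<close>

text \<open>\<open>D\<close> below is the reversed and reflected walk from \<open>r\<close>. It lives on the lattice points of
  the opposite parity, hence it can only touch the walk from \<open>l\<close> where both are absorbed at 0.\<close>

lemma walks_absorbed_together:
  assumes l: "0 \<le> l" "l \<le> int p" "even l" and r: "0 \<le> r" "r < int p" "even r"
    and lp: "walk l p = 0" and rp: "walk r p = int p"
  shows "\<exists>n\<in>{1..p}. walk l n = 0 \<and> walk r (p + 1 - n) = int p"
proof (rule ccontr)
  assume no_meet: "\<not> ?thesis"
  define D where "D n = int p - walk r (p + 1 - n)" for n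
  \<comment> \<open>Descending induction on the time p - j carries the strict order from time p back
    to time 1, where \<open>D 1 = 0\<close> makes it impossible.\<close>
  have below: "walk l (p - j) < D (p - j)" if "j < p" for j
    using that
  proof (induction j)
    case 0
    then show ?case using lp r by (simp add: D_def)
  next
    case (Suc j)
    define n where "n = p - Suc j"
    have n: "1 \<le> n" "n < p" "p - j = Suc n" using Suc.prems by (auto simp: n_def)
    then have less: "walk l (Suc n) < D (Suc n)" using Suc by simp
    define x where "x = walk l n"
    define y where "y = D (Suc n)"
    have x_step: "walk l (Suc n) = x + chi (int n) * chi x" by (simp add: x_def)
    have y_eq: "y = int p - walk r (p - n)" by (simp add: y_def D_def)
    have "p + 1 - n = Suc (p - n)" using n by simp
    then have "D n = y - chi (int (p - n)) * chi (walk r (p - n))"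
      by (simp add: D_def y_eq)
    also have "int (p - n) = int p - int n" using n by simp
    also have "walk r (p - n) = int p - y" by (simp add: y_eq)
    \<comment> \<open>Between times n and n + 1, \<open>D\<close> reads its sign at its later value
      y, whereas the walk from l reads it at its earlier value x.\<close>
    finally have D_step: "D n = y - chi (int n) * chi y" by (simp only: chi_diff_p)
    have x_ge: "0 \<le> x" "x \<le> int p" using walk_bounds[OF l(1,2)] by (auto simp: x_def)
    have D_ge: "0 \<le> D n" using walk_bounds[of r] r by (simp add: D_def)
    have y_pos: "0 < y" using less walk_bounds[OF l(1,2), of "Suc n"] by (simp add: y_def)
    have "x < D n"
    proof (cases "x = 0")
      case True
      moreover have "D n \<noteq> 0"
        using no_meet True n by (auto simp: x_def D_def)
      ultimately show ?thesis using D_ge by simp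
    next
      case False
      have "x \<noteq> int p"
      proof
        assume "x = int p"
        then have "walk l p = int p" using walk_absorbed[of l n p] n by (simp add: x_def)
        then show False using lp p_ge_5 by simp
      qed
      then have nx: "\<not> int p dvd x" using False x_ge by (intro not_dvd_strictly_between) auto
      have "y \<noteq> int p"
      proof
        assume "y = int p"
        then have "walk r (p - n) = 0" by (simp add: y_eq)
        then have "walk r p = 0" using walk_absorbed[of r "p - n" p] by simp
        then show False using rp p_ge_5 by simp
      qed
      moreover have "y \<le> int p" using walk_bounds[of r] r by (simp add: y_eq)
      ultimately have ny: "\<not> int p dvd y" using y_pos by (intro not_dvd_strictly_between) auto
      have nn: "\<not> int p dvd int n" using n by (intro not_dvd_strictly_between) auto
      have "even (x - l - int (n - 1))"
        using walk_parity[of "n - 1" l] n nx by (simp add: x_def)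
      then have "even (x - int n - 1)" using l n by (simp add: of_nat_diff)
      moreover have "even (walk r (p - n) - r - int (p - n - 1))"
      proof -
        have "\<not> int p dvd walk r (p - n)" using ny by (simp add: y_eq dvd_diff_right_iff)
        moreover have "Suc (p - n - 1) = p - n" "p - n - 1 < p" using n by auto
        ultimately show ?thesis using walk_parity[of "p - n - 1" r] by metis
      qed
      then have "even (int p - y - (int p - int n - 1))"
        using r n by (simp add: y_eq of_nat_diff)
      ultimately have par: "even (x - y)" by simp
      \<comment> \<open>If x < y, parity makes the gap at least 2, too wide for one backward step of
        \<open>D\<close> to close. If x = y, both read the same sign; it must be -1 for the walk to
        stay below y, so \<open>D n\<close> is y + 1.\<close>
      have "x < y \<or> x = y"
        using less x_step chi_prod_bounds[of "int n" x] unfolding y_def by linarith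
      then show ?thesis
      proof
        assume "x < y"
        then have "x + 2 \<le> y" using par by presburger
        then show ?thesis using D_step chi_prod_bounds[of "int n" y] by linarith
      next
        assume "x = y"
        then have "chi (int n) * chi x = -1"
          using less x_step chi_prod_sign[OF nn nx] by (auto simp: y_def)
        then show ?thesis using D_step \<open>x = y\<close> by simp
      qed
    qed
    then show ?case by (simp add: x_def n_def)
  qed
  have "walk l 1 < D 1" using below[of "p - 1"] p_ge_5 by simp
  then show False using l rp by (simp add: D_def)
qed

text \<open>At time 1 the walks are still at l and l + 2, so the speed limit forces the common index
  n to be l + 1 or l + 2. Either way one walk has no slack and the other a single spare step, which
  parity rules out.\<close>

lemma straight_walks:
  fixes l :: nat
  assumes l: "even l" "l + 2 < p"
    and lp: "walk (int l) p = 0" and rp: "walk (int l + 2) p = int p"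
  shows "walk (int l) (l + 1) = 0" "walk (int l + 2) (p - l - 1) = int p"
proof -
  let ?r = "int l + 2"
  obtain n where n: "1 \<le> n" "n \<le> p" "walk (int l) n = 0" "walk ?r (p + 1 - n) = int p"
    using walks_absorbed_together[of "int l" ?r] l lp rp by auto
  have n1: "l + 1 \<le> n" using walk_diff_le[of 1 n "int l"] n by simp
  have n2: "n \<le> l + 2" 
    using walk_diff_le[of 1 "p + 1 - n" ?r] n l by (simp add: of_nat_diff Suc_diff_le)
  show "walk (int l) (l + 1) = 0"
  proof (rule ccontr)
    assume nz: "walk (int l) (l + 1) \<noteq> 0"
    then have n_eq: "n = Suc (l + 1)" using n1 n2 n(3) by (cases "n = l + 1") auto
    have "\<not> int p dvd walk (int l) (l + 1)"
      using walk_absorbed[of "int l" "l + 1" n] n_eq nz n(3) by auto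
    then have "even (walk (int l) (l + 1) - int l - int l)"
      using walk_parity[of l "int l"] l by simp
    moreover have "\<bar>walk (int l) (l + 1)\<bar> \<le> 1"
      using walk_diff_le[of "l + 1" n "int l"] n_eq n(3) by simp
    ultimately show False using nz by presburger
  qed
  show "walk ?r (p - l - 1) = int p"
  proof (rule ccontr)
    let ?w = "walk ?r (p - l - 1)"
    assume nz: "?w \<noteq> int p"
    then have n_eq: "n = l + 1"
      using n1 n2 n(4) by (cases "n = l + 2") (auto simp: numeral_2_eq_2)
    have r_p: "walk ?r (p - l) = int p" using n(4) n_eq l by simp
    have Suc_eq: "p - l - 1 = Suc (p - l - 2)" using l by simp
    have "\<not> int p dvd ?w"
      using walk_absorbed[of ?r "p - l - 1" "p - l"] r_p nz diff_le_self by metis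
    then have "even (?w - ?r - int (p - l - 2))"
      using walk_parity[of "p - l - 2" ?r] l Suc_eq by simp
    then have "even (?w - int p)" using l by (simp add: of_nat_diff)
    moreover have "\<bar>int p - ?w\<bar> \<le> 1"
      using walk_diff_le[of "p - l - 1" "p - l" ?r] r_p l by (simp add: of_nat_diff)
    ultimately show False using nz by presburger
  qed
qed

text \<open>A straight walk has a known position at each time, so each of its steps reveals one
  product of \<open>chi\<close> values.\<close>

lemma not_absorbed_at_opposite_ends:
  fixes l :: nat
  assumes "p \<ge> 13" and l: "even l" "l + 2 < p"
    and lp: "walk (int l) p = 0" and rp: "walk (int l + 2) p = int p"
  shows False
proof (rule no_antisymmetry_symmetry[OF assms(1), of "int l + 1"])
  let ?r = "int l + 2"
  note straight = straight_walks[OF l lp rp]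
  show "chi n * chi (int l + 1 - n) = -1" if "1 \<le> n" "n < int l + 1" for n
  proof -
    define j where "j = nat n"
    have j: "n = int j" "1 \<le> j" "j \<le> l" using that by (auto simp: j_def)
    \<comment> \<open>The speed limit from time 1 bounds the position from below, the one towards
      absorption from above.\<close>
    have pos: "walk (int l) i = int l + 1 - int i" if "1 \<le> i" "i \<le> l + 1" for i
      using walk_diff_le[of 1 i "int l"] walk_diff_le[of i "l + 1" "int l"] straight(1) that
      by simp
    show ?thesis using pos[of j] pos[of "Suc j"] j by simp
  qed
  show "chi n * chi (int l + 1 + n) = 1" if "1 \<le> n" "n < int p - (int l + 1)" for n
  proof -
    define j where "j = nat n"
    have j: "n = int j" "1 \<le> j" "j < p - l - 1" using that by (auto simp: j_def)
    have pos: "walk ?r i = int l + 1 + int i" if "1 \<le> i" "i \<le> p - l - 1" for i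
      using walk_diff_le[of 1 i ?r] walk_diff_le[of i "p - l - 1" ?r] straight(2) that l
      by (simp add: of_nat_diff)
    show ?thesis using pos[of j] pos[of "Suc j"] j by simp
  qed
qed (use l in auto)

text \<open>Otherwise induction along the even starting points carries absorption at 0 from the
  start 0 up to p - 1, whose walk enters p at time 2.\<close>

lemma unabsorbed_walk_exists:
  assumes "p \<ge> 13"
  shows "\<exists>l. even l \<and> 2 \<le> l \<and> l \<le> p - 3 \<and> \<not> int p dvd walk (int l) p"
proof (rule ccontr)
  assume none: "\<not> ?thesis"
  have odd_p: "odd p" using p_mod_4 by (simp add: cong_def) presburger
  have "walk (int p - 1) 2 = int p"
    using chi_diff_p[of 1] by (simp add: numeral_2_eq_2)
  then have last: "walk (int p - 1) p = int p"
    using walk_absorbed[of "int p - 1" 2 p] p_ge_5 by simp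
  have "walk (int (2 * j)) p = 0" if "2 * j \<le> p - 1" for j
    using that
  proof (induction j)
    case 0
    then show ?case using walk_absorbed[of 0 0 p] by simp
  next
    case (Suc j)
    have "int p dvd walk (int (2 * j) + 2) p"
    proof (cases "2 * Suc j \<le> p - 3")
      case True
      then show ?thesis using none[simplified, rule_format, of "2 * Suc j"] by (simp add: add.commute)
    next
      case False
      then have "int (2 * j) + 2 = int p - 1" using Suc.prems odd_p by presburger
      then show ?thesis using last by (metis dvd_refl)
    qed
    moreover have "walk (int (2 * j) + 2) p \<noteq> int p"
      using not_absorbed_at_opposite_ends[OF assms, of "2 * j"] Suc p_ge_5 by fastforce
    moreover have "0 \<le> walk (int (2 * j) + 2) p \<and> walk (int (2 * j) + 2) p \<le> int p"
      using Suc.prems by (intro walk_bounds) auto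
    ultimately have "walk (int (2 * j) + 2) p = 0"
      using not_dvd_strictly_between by (metis order_le_less)
    then show ?case by (simp add: add.commute)
  qed
  from this[of "(p - 1) div 2"] have "walk (int p - 1) p = 0"
    using odd_p p_ge_5 by (simp add: of_nat_diff)
  then show False using last p_ge_5 by simp
qed

section \<open>Goebel numbers modulo p\<close>

lemma chi_power_odd_multiple:
  assumes "odd m"
  shows "[x ^ (m * ((p - 1) div 2)) = chi x] (mod int p)"
proof -
  have "[(x ^ ((p - 1) div 2)) ^ m = chi x ^ m] (mod int p)"
    by (intro cong_pow cong_sym[OF chi_power])
  moreover have "chi x ^ m = chi x"
    using chi_cases[of x] assms odd_pos by (elim disjE) auto
  ultimately show ?thesis by (simp add: mult.commute flip: power_mult)
qed

text \<open>The error term expresses congruence modulo p in the localization at p. Each step divides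
  only by some n < p, so the claim on n times the Goebel number extends to n = p.\<close>

lemma goebel_cong_walk:
  assumes k: "k = m * ((p - 1) div 2)" "odd m" and l: "[int l' = l] (mod int p)"
    and n: "1 \<le> n" "n \<le> p"
  shows "\<exists>a b. \<not> int p dvd b \<and>
    of_nat n * goebel k l' n = of_int (walk l n) + of_nat p * of_int a / of_int b"
  using n
proof (induction n rule: dec_induct)
  case base
  obtain t where "int l' = l + int p * t" using l by (metis cong_iff_lin cong_sym)
  then have "(of_nat l' :: rat) = of_int l + of_nat p * of_int t"
    by (metis of_int_add of_int_mult of_int_of_nat_eq)
  moreover have "\<not> int p dvd 1" using p_ge_5 by (intro not_dvd_strictly_between) auto
  ultimately show ?case
    by (intro exI[of _ t] exI[of _ 1]) (simp add: goebel_1[unfolded One_nat_def])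
next
  case (step n)
  define g where "g = goebel k l' n"
  define w where "w = walk l n"
  define e where "e = chi (int n) * chi w"
  obtain a b where b: "\<not> int p dvd b"
    and ab: "of_nat n * g = of_int w + of_nat p * of_int a / of_int b"
    using step by (auto simp: g_def w_def)
  define c where "c = w * b + int p * a"
  define d where "d = (int n * b) ^ k"
  have k1: "k \<ge> 1" using k p_ge_5 odd_pos[of m] by (simp add: Suc_le_eq)
  have nn: "\<not> int p dvd int n" using step by (intro not_dvd_strictly_between) auto
  have nb: "\<not> int p dvd int n * b" using nn b prime_int_p prime_dvd_multD by blast
  have d: "\<not> int p dvd d" using nb prime_int_p prime_dvd_power unfolding d_def by blast
  have b0: "b \<noteq> 0" and d0: "d \<noteq> 0" using b d by auto
  \<comment> \<open>This is \<open>g ^ k\<close> congruent to \<open>e\<close> with the denominator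
    \<open>d\<close> cleared.\<close>
  have "[c ^ k - e * d = chi c - e * chi (int n * b)] (mod int p)"
    unfolding d_def k(1) by (intro cong_diff cong_mult cong_refl chi_power_odd_multiple k)
  moreover have "chi c = chi w * chi b"
    using chi_cong[of c "w * b"] by (simp add: c_def cong_iff_dvd_diff chi_mult)
  moreover have "chi (int n) * chi (int n) = 1" using nn by (rule chi_square)
  ultimately have "int p dvd c ^ k - e * d"
    by (simp add: e_def chi_mult cong_0_iff algebra_simps)
  then obtain t where t: "c ^ k - e * d = int p * t" by blast
  have "g = of_int c / of_int (int n * b)"
    using ab b0 step.hyps by (simp add: c_def field_simps)
  then have "g ^ k = of_int (c ^ k) / of_int d" by (simp add: d_def power_divide)
  also have "c ^ k = e * d + int p * t" using t by simp
  also have "of_int (e * d + int p * t) / of_int d = (of_int e + of_nat p * of_int t / of_int d :: rat)"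
    using d0 by (simp add: add_divide_distrib)
  finally have gk: "g ^ k = of_int e + of_nat p * of_int t / of_int d" .
  have "of_nat (Suc n) * goebel k l' (Suc n) = g * (of_nat n + g ^ (k - 1))"
    using goebel_Suc[of k n l'] k1 step.hyps by (simp add: g_def)
  also have "\<dots> = of_nat n * g + g ^ k"
    using power_Suc[of g "k - 1"] k1 by (simp add: algebra_simps)
  also have "\<dots> = of_int (w + e) + of_nat p * of_int (a * d + t * b) / of_int (b * d)"
    unfolding ab gk using b0 d0 by (simp add: field_simps)
  finally have "of_nat (Suc n) * goebel k l' (Suc n)
      = of_int (walk l (Suc n)) + of_nat p * of_int (a * d + t * b) / of_int (b * d)"
    by (simp add: w_def e_def)
  moreover have "\<not> int p dvd b * d" using b d prime_int_p prime_dvd_multD by blast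
  ultimately show ?case by blast
qed

text \<open>If the p-th term were p-integral, p times it would be divisible by p in the
  localization, and so would \<open>walk l p\<close>.\<close>

lemma goebel_not_in_localization:
  assumes "k = m * ((p - 1) div 2)" "odd m" "[int l' = l] (mod int p)"
    and w: "\<not> int p dvd walk l p"
  shows "goebel k l' p \<notin> int_localization p"
proof
  assume "goebel k l' p \<in> int_localization p"
  then obtain u v where v: "\<not> int p dvd v" and uv: "goebel k l' p = of_int u / of_int v"
    by (auto simp: int_localization_def)
  obtain a b where b: "\<not> int p dvd b"
    and ab: "of_nat p * goebel k l' p = of_int (walk l p) + of_nat p * of_int a / of_int b"
    using goebel_cong_walk[OF assms(1-3), of p] p_ge_5 by auto
  have "v \<noteq> 0" "b \<noteq> 0" using v b by auto
  then have "of_int (walk l p * (v * b)) = (of_int (int p * (u * b - a * v)) :: rat)"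
    using ab uv by (simp add: field_simps)
  then have "walk l p * (v * b) = int p * (u * b - a * v)" by (simp only: of_int_eq_iff)
  then have "int p dvd walk l p * (v * b)" by simp
  then show False using w v b prime_int_p prime_dvd_multD by blast
qed

end

theorem corollary1p2:
  fixes k p :: nat
  assumes "k > 0" and "even k"
    and "prime p" and "p \<ge> 13" and "[p = 1] (mod 4)"
    and "\<exists>m. odd m \<and> k = m * ((p - 1) div 2)"
  shows "\<exists>l. even l \<and> 2 \<le> l \<and> l \<le> p - 3 \<and>
    (\<forall>l'. l' > 0 \<and> [l' = l] (mod p) \<longrightarrow>
      goebel k l' p \<notin> int_localization p \<and> goebel_N k l' \<le> enat p)"
proof -
  interpret prime_1_mod_4 p
    using assms by unfold_locales
  obtain m where m: "odd m" "k = m * ((p - 1) div 2)" using assms by blast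
  obtain l where l: "even l" "2 \<le> l" "l \<le> p - 3" "\<not> int p dvd walk (int l) p"
    using unabsorbed_walk_exists \<open>p \<ge> 13\<close> by blast
  have "goebel k l' p \<notin> int_localization p \<and> goebel_N k l' \<le> enat p" if "[l' = l] (mod p)" for l'
  proof
    show loc: "goebel k l' p \<notin> int_localization p"
      using goebel_not_in_localization[OF m(2,1) _ l(4), of l'] that by (simp add: cong_int_iff)
    have "of_int z \<in> int_localization p" for z
      unfolding int_localization_def mem_Collect_eq
      by (intro exI[of _ z] exI[of _ 1]) (use \<open>p \<ge> 13\<close> in auto)
    then have "goebel k l' p \<notin> \<int>" using loc by (auto elim!: Ints_cases)
    then show "goebel_N k l' \<le> enat p"
      using \<open>p \<ge> 13\<close> unfolding goebel_N_def by (intro Inf_lower) auto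
  qed
  then show ?thesis using l by blast
qed

end
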